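(* Let $k\ge1$ be an integer. Then $$B(2k-1)=\sum_{\lambda\in\Gamma_{k-\frac12}}\big(m^\lambda_{k-\frac12}\big)^2 .$$
   Context: $B(\ell)$ is the number of set partitions of $\{1,\ldots,\ell\}$. Integer partitions are identified with Young diagrams. $\Gamma_{k-\frac12}$ is the set of integer partitions $\lambda$ with $0\le|\lambda|\le k-\frac12$ (equivalently $|\lambda|\le k-1$). $m^\lambda_{k-\frac12}$ is the number of vacillating tableaux of shape $\lambda$ and length $2k-1$, i.e. of sequences of partitions $(\emptyset=\lambda^{(0)},\lambda^{(1/2)},\lambda^{(1)},\ldots,\lambda^{(k-1)},\lambda^{(k-1/2)}=\lambda)$ such that, for each integer $i$, $\lambda^{(i+1/2)}$ equals $\lambda^{(i)}$ or is obtained from it by removing one box, and $\lambda^{(i+1)}$ equals $\lambda^{(i+1/2)}$ or is obtained from it by adding one box (whenever these terms occur in the sequence). *)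

theory Defs
  imports Complex_Main "HOL-Library.Disjoint_Sets"
begin

definition bell :: "nat \<Rightarrow> nat" where
  "bell l = card {P. partition_on {1..l} P}"

(* An integer partition is the weakly decreasing list of its (positive) parts;
   the empty partition is []. *)
definition integer_partition :: "nat list \<Rightarrow> bool" where
  "integer_partition lam \<longleftrightarrow> sorted_wrt (\<ge>) lam \<and> 0 \<notin> set lam"

definition young_diagram :: "nat list \<Rightarrow> (nat \<times> nat) set" where
  "young_diagram lam = {(i, j). i < length lam \<and> j < lam ! i}"

definition remove_box :: "nat list \<Rightarrow> nat list \<Rightarrow> bool" where
  "remove_box lam mu \<longleftrightarrow> integer_partition lam \<and> integer_partition mu \<and>
     (\<exists>b \<in> young_diagram lam. young_diagram mu = young_diagram lam - {b})"

definition add_box :: "nat list \<Rightarrow> nat list \<Rightarrow> bool" where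
  "add_box lam mu \<longleftrightarrow> integer_partition lam \<and> integer_partition mu \<and>
     (\<exists>b. b \<notin> young_diagram lam \<and> young_diagram mu = insert b (young_diagram lam))"

definition Gamma :: "real \<Rightarrow> nat list set" where
  "Gamma r = {lam. integer_partition lam \<and> real (sum_list lam) \<le> r}"

(* The length n counts steps, so there are n + 1 partitions; the entry T ! j stands for
   the partition with half-integer index j / 2. *)
definition vacillating_tableaux :: "nat \<Rightarrow> nat list \<Rightarrow> nat list list set" where
  "vacillating_tableaux n lam =
     {T. length T = n + 1 \<and> (\<forall>mu \<in> set T. integer_partition mu) \<and>
         T ! 0 = [] \<and> T ! n = lam \<and>
         (\<forall>i. 2 * i + 1 \<le> n \<longrightarrow>
            T ! (2 * i + 1) = T ! (2 * i) \<or> remove_box (T ! (2 * i)) (T ! (2 * i + 1))) \<and>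
         (\<forall>i. 2 * i + 2 \<le> n \<longrightarrow>
            T ! (2 * i + 2) = T ! (2 * i + 1) \<or> add_box (T ! (2 * i + 1)) (T ! (2 * i + 2)))}"

(* m_half k lam is the multiplicity with half-integer index k - 1/2 (for k >= 1). *)
definition m_half :: "nat \<Rightarrow> nat list \<Rightarrow> nat" where
  "m_half k lam = card (vacillating_tableaux (2 * k - 1) lam)"

end

(* Let D and U delete and add a box in Young's lattice, acting on functions on Young diagrams. Since
   a diagram has one more addable than removable box and the lattice of diagrams is distributive,
   DU = UD + 1, so A = 1 + D and B = 1 + U satisfy AB = BA + 1. With \<delta> the indicator of the empty
   diagram, A \<delta> = \<delta>, hence BA B^j \<delta> = B^(j+1) \<delta> + j B^j \<delta>. This is the recursion for inserting
   one more element into a set partition with j blocks (as a new block, or into one of the j blocks),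
   so (BA)^n \<delta> is the sum of B^(card P) \<delta> over all partitions P of {1..n}, whose value at the empty
   diagram is B(n). On the other hand the multiplicities at index k - 1/2 are the values of
   A(BA)^(k-1) \<delta>, and since A and B are adjoint, their sum of squares is (BA)^(2k-1) \<delta> at the
   empty diagram. *)
theory Submission
  imports Defs
begin

section \<open>Young diagrams as finite down-closed sets of cells\<close>

text \<open>Sets of cells replace lists of parts here because adding or removing a box is then
  \<open>insert\<close> or set difference, and the lattice operations are plain union and
  intersection.\<close>

definition young_diagrams :: "(nat \<times> nat) set set" where
  "young_diagrams = {Y. finite Y \<and> (\<forall>i j i' j'. (i, j) \<in> Y \<longrightarrow> i' \<le> i \<longrightarrow> j' \<le> j \<longrightarrow> (i', j') \<in> Y)}"

lemma young_diagrams_Un: "X \<in> young_diagrams \<Longrightarrow> Y \<in> young_diagrams \<Longrightarrow> X \<union> Y \<in> young_diagrams"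
  unfolding young_diagrams_def by blast

lemma young_diagrams_Int: "X \<in> young_diagrams \<Longrightarrow> Y \<in> young_diagrams \<Longrightarrow> X \<inter> Y \<in> young_diagrams"
  unfolding young_diagrams_def by blast

lemma finite_young_diagram: "Y \<in> young_diagrams \<Longrightarrow> finite Y"
  by (simp add: young_diagrams_def)

lemma empty_in_young_diagrams [simp]: "{} \<in> young_diagrams"
  by (simp add: young_diagrams_def)

text \<open>A cell \<open>(i, j)\<close> forces \<open>i + 1\<close> cells above it in its column
  and \<open>j + 1\<close> cells in its row, so a bound on the size confines the diagram to a fixed
  square. This keeps sums over diagrams of bounded size finite.\<close>

lemma finite_young_diagrams_card_le: "finite {Y \<in> young_diagrams. card Y \<le> n}"
proof (rule finite_subset)
  show "{Y \<in> young_diagrams. card Y \<le> n} \<subseteq> Pow ({..n} \<times> {..n})"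
  proof clarify
    fix Y i j assume Y: "Y \<in> young_diagrams" "card Y \<le> n" "(i, j) \<in> Y"
    then have fin: "finite Y" by (simp add: finite_young_diagram)
    have "(\<lambda>a. (a, j)) ` {..i} \<subseteq> Y" "Pair i ` {..j} \<subseteq> Y"
      using Y unfolding young_diagrams_def by auto
    then have "card ((\<lambda>a. (a, j)) ` {..i}) \<le> card Y" "card (Pair i ` {..j}) \<le> card Y"
      using fin card_mono by blast+
    moreover have "card ((\<lambda>a. (a, j)) ` {..i}) = Suc i" "card (Pair i ` {..j}) = Suc j"
      by (simp_all add: card_image inj_on_def)
    ultimately show "i \<in> {..n} \<and> j \<in> {..n}"
      using Y(2) by auto
  qed
qed simp

text \<open>Row \<open>i\<close> of a down-closed set is an initial segment, so its length is the
  first column index missing from it.\<close>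

lemma young_diagrams_row_lengths:
  assumes "Y \<in> young_diagrams"
  obtains r where "antimono r" "finite {i. r i \<noteq> 0}" "Y = {(i, j). j < r i}"
proof
  define r where "r i = (LEAST j. (i, j) \<notin> Y)" for i
  have fin: "finite Y" and down: "\<And>i j i' j'. (i, j) \<in> Y \<Longrightarrow> i' \<le> i \<Longrightarrow> j' \<le> j \<Longrightarrow> (i', j') \<in> Y"
    using assms unfolding young_diagrams_def by blast+
  have ex: "\<exists>j. (i, j) \<notin> Y" for i
  proof (rule ccontr)
    assume "\<nexists>j. (i, j) \<notin> Y"
    then have "range (Pair i) \<subseteq> Y" by auto
    then show False
      using fin finite_subset finite_imageD[of "Pair i" UNIV] by (auto simp: inj_on_def)
  qed
  have mem: "(i, j) \<in> Y \<longleftrightarrow> j < r i" for i j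
    using LeastI_ex[OF ex[of i]] not_less_Least[of j "\<lambda>j. (i, j) \<notin> Y"] down[of i j i "r i"]
    unfolding r_def by (meson le_refl linorder_not_le)
  then show "Y = {(i, j). j < r i}" by auto
  show "antimono r"
    by (rule antimonoI) (metis down le_refl linorder_not_le mem)
  have "{i. r i \<noteq> 0} \<subseteq> fst ` Y"
    using mem by force
  then show "finite {i. r i \<noteq> 0}"
    using fin finite_subset by blast
qed

text \<open>Reduces the question whether an altered diagram is still a diagram to the monotonicity
  of its altered row lengths.\<close>

lemma row_lengths_in_young_diagrams_iff:
  "{(i, j). j < r i} \<in> young_diagrams \<longleftrightarrow> antimono r \<and> finite {i. r i \<noteq> (0::nat)}"
  (is "?Y \<in> _ \<longleftrightarrow> _")
proof
  assume Y: "?Y \<in> young_diagrams"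
  then obtain s where s: "antimono s" "finite {i. s i \<noteq> 0}" "?Y = {(i, j). j < s i}"
    by (rule young_diagrams_row_lengths)
  \<comment> \<open>A set of this form determines its row lengths, so the properties of
    \<open>s\<close> carry over to \<open>r\<close>.\<close>
  have "r i = s i" for i
  proof -
    have "{j. (i, j) \<in> ?Y} = {..<s i}" by (subst s(3)) auto
    moreover have "{j. (i, j) \<in> ?Y} = {..<r i}" by auto
    ultimately show ?thesis by simp
  qed
  then have "r = s" by blast
  then show "antimono r \<and> finite {i. r i \<noteq> 0}" using s by simp
next
  assume r: "antimono r \<and> finite {i. r i \<noteq> 0}"
  have "?Y = (SIGMA i:{i. r i \<noteq> 0}. {..<r i})" by auto
  then have "finite ?Y" using r by simp
  then show "?Y \<in> young_diagrams"
    using antimonoD[of r] r unfolding young_diagrams_def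
    by (auto intro: le_less_trans less_le_trans)
qed

section \<open>Addable and removable boxes\<close>

definition addable :: "(nat \<times> nat) set \<Rightarrow> (nat \<times> nat) set" where
  "addable Y = {b. b \<notin> Y \<and> insert b Y \<in> young_diagrams}"

definition removable :: "(nat \<times> nat) set \<Rightarrow> (nat \<times> nat) set" where
  "removable Y = {b \<in> Y. Y - {b} \<in> young_diagrams}"

text \<open>Removable boxes end the rows that are strictly longer than the next row; addable boxes
  extend row 0 and the rows directly below those. Row 0 accounts for the extra addable box. All
  three facts are read off these descriptions.\<close>

lemma addable_removable:
  assumes "Y \<in> young_diagrams"
  shows finite_addable: "finite (addable Y)"
    and finite_removable: "finite (removable Y)"
    and card_addable: "card (addable Y) = Suc (card (removable Y))"
proof -
  obtain r where r: "antimono r" "finite {i. r i \<noteq> 0}" and Y: "Y = {(i, j). j < r i}"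
    using assms by (rule young_diagrams_row_lengths)
  define I where "I = {i. r (Suc i) < r i}"
  have mono: "r i' \<le> r i" if "i \<le> i'" for i i' using r(1) that by (rule antimonoD)
  have finI: "finite I"
    by (rule finite_subset[OF _ r(2)]) (auto simp: I_def)
  have add: "addable Y = (\<lambda>i. (i, r i)) ` insert 0 (Suc ` I)"
  proof (intro equalityI subsetI)
    fix b assume "b \<in> addable Y"
    then obtain i j where b: "b = (i, j)" "j \<ge> r i" and D: "insert (i, j) Y \<in> young_diagrams"
      unfolding addable_def Y by (cases b) auto
    have down: "(i', j') \<in> Y" if "i' \<le> i" "j' \<le> j" "(i', j') \<noteq> (i, j)" for i' j'
      using D that unfolding young_diagrams_def by blast
    have "j = r i"
      using down[of i "r i"] b Y by auto
    \<comment> \<open>For \<open>i > 0\<close> the box directly above the new one must already lie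
      in \<open>Y\<close>, so row \<open>i - 1\<close> is strictly longer than row
      \<open>i\<close>.\<close>
    moreover have "i = 0 \<or> i \<in> Suc ` I"
      using down[of "i - 1" j] b Y \<open>j = r i\<close> by (cases i) (auto simp: I_def)
    ultimately show "b \<in> (\<lambda>i. (i, r i)) ` insert 0 (Suc ` I)" using b by auto
  next
    fix b assume "b \<in> (\<lambda>i. (i, r i)) ` insert 0 (Suc ` I)"
    then obtain i where i: "b = (i, r i)" "i = 0 \<or> r i < r (i - 1)" by (auto simp: I_def)
    have "insert b Y = {(a, j). j < (r(i := Suc (r i))) a}"
      using i by (auto simp: Y split: if_splits)
    moreover have "antimono (r(i := Suc (r i)))"
    proof (rule antimonoI)
      fix x y :: nat assume "x \<le> y"
      \<comment> \<open>The new length \<open>Suc (r i)\<close> is at most \<open>r (i - 1)\<close>,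
        hence at most the length of every earlier row.\<close>
      moreover have "r (i - 1) \<le> r x" if "x < i"
        by (rule mono) (use that in linarith)
      ultimately show "(r(i := Suc (r i))) y \<le> (r(i := Suc (r i))) x"
        using i(2) mono[of x y] by (cases "x < i") auto
    qed
    moreover have "finite {a. (r(i := Suc (r i))) a \<noteq> 0}"
      by (rule finite_subset[of _ "insert i {i. r i \<noteq> 0}"]) (use r in auto)
    ultimately have "insert b Y \<in> young_diagrams"
      by (simp only: row_lengths_in_young_diagrams_iff simp_thms)
    then show "b \<in> addable Y"
      using i by (simp add: addable_def Y)
  qed
  have rem: "removable Y = (\<lambda>i. (i, r i - 1)) ` I"
  proof (intro equalityI subsetI)
    fix b assume "b \<in> removable Y"
    then obtain i j where b: "b = (i, j)" "j < r i" and D: "Y - {(i, j)} \<in> young_diagrams"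
      unfolding removable_def Y by (cases b) auto
    have up: "(i', j') \<notin> Y" if "i \<le> i'" "j \<le> j'" "(i', j') \<noteq> (i, j)" for i' j'
      using D that unfolding young_diagrams_def by blast
    have "j \<le> r i - 1" using b by linarith
    then have "j = r i - 1"
      using up[of i "r i - 1"] b by (cases "j = r i - 1") (auto simp: Y)
    moreover have "i \<in> I"
      using up[of "Suc i" j] b by (auto simp: Y I_def)
    ultimately show "b \<in> (\<lambda>i. (i, r i - 1)) ` I" using b by auto
  next
    fix b assume "b \<in> (\<lambda>i. (i, r i - 1)) ` I"
    then obtain i where i: "b = (i, r i - 1)" "r (Suc i) < r i" by (auto simp: I_def)
    have "Y - {b} = {(a, j). j < (r(i := r i - 1)) a}"
      using i by (auto simp: Y split: if_splits)
    \<comment> \<open>Rows below \<open>i\<close> have length at most \<open>r (Suc i)\<close>,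
      which is at most \<open>r i - 1\<close>.\<close>
    moreover have "antimono (r(i := r i - 1))"
    proof (rule antimonoI)
      fix x y :: nat assume "x \<le> y"
      then show "(r(i := r i - 1)) y \<le> (r(i := r i - 1)) x"
        using i(2) mono[of x y] mono[of "Suc i" y] by (cases "i < y") auto
    qed
    moreover have "finite {a. (r(i := r i - 1)) a \<noteq> 0}"
      by (rule finite_subset[OF _ r(2)]) auto
    ultimately have "Y - {b} \<in> young_diagrams"
      by (simp only: row_lengths_in_young_diagrams_iff simp_thms)
    then show "b \<in> removable Y"
      using i by (simp add: removable_def Y)
  qed
  show "finite (addable Y)" "finite (removable Y)"
    using finI by (simp_all add: add rem)
  have "card (addable Y) = card (insert 0 (Suc ` I))"
    unfolding add by (rule card_image) (simp add: inj_on_def)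
  also have "\<dots> = Suc (card I)"
    using finI by (simp add: card_insert_if card_image)
  also have "card I = card (removable Y)"
    unfolding rem by (rule card_image[symmetric]) (simp add: inj_on_def)
  finally show "card (addable Y) = Suc (card (removable Y))" .
qed

section \<open>Box operators and their commutation relation\<close>

text \<open>This is U pushing a function forward along added boxes: the value at \<open>Y\<close>
  collects the diagrams from which \<open>Y\<close> arises, so the formula removes boxes. Dually,
  \<open>down\<close> is D and its formula adds boxes.\<close>

definition up :: "((nat \<times> nat) set \<Rightarrow> nat) \<Rightarrow> (nat \<times> nat) set \<Rightarrow> nat" where
  "up f Y = (\<Sum>b\<in>removable Y. f (Y - {b}))"

definition down :: "((nat \<times> nat) set \<Rightarrow> nat) \<Rightarrow> (nat \<times> nat) set \<Rightarrow> nat" where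
  "down f Y = (\<Sum>b\<in>addable Y. f (insert b Y))"

lemma insert_addable: "b \<in> addable Y \<Longrightarrow> insert b Y \<in> young_diagrams"
  by (simp add: addable_def)

lemma remove_removable: "b \<in> removable Y \<Longrightarrow> Y - {b} \<in> young_diagrams"
  by (simp add: removable_def)

text \<open>Adding \<open>b\<close> and then removing \<open>c \<noteq> b\<close> commutes with the opposite order because diagrams are
  closed under union and intersection; the terms with \<open>b = c\<close> are counted by card_addable.\<close>
lemma down_up:
  assumes Y: "Y \<in> young_diagrams"
  shows "down (up f) Y = up (down f) Y + f Y"
proof -
  let ?S = "SIGMA b:addable Y. removable (insert b Y) - {b}"
  let ?T = "SIGMA c:removable Y. addable (Y - {c}) - {c}"
  have "down (up f) Y = (\<Sum>b\<in>addable Y. f Y + (\<Sum>c\<in>removable (insert b Y) - {b}. f (insert b Y - {c})))"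
    unfolding down_def up_def
  proof (rule sum.cong[OF refl])
    fix b assume b: "b \<in> addable Y"
    then have "b \<in> removable (insert b Y)" "insert b Y - {b} = Y"
      using Y by (auto simp: addable_def removable_def)
    then show "(\<Sum>c\<in>removable (insert b Y). f (insert b Y - {c}))
        = f Y + (\<Sum>c\<in>removable (insert b Y) - {b}. f (insert b Y - {c}))"
      using finite_removable[OF insert_addable[OF b]] by (simp add: sum.remove)
  qed
  also have "\<dots> = card (addable Y) * f Y + (\<Sum>(b, c)\<in>?S. f (insert b Y - {c}))"
    using Y by (simp add: sum.distrib sum.Sigma finite_addable finite_removable insert_addable)
  finally have du: "down (up f) Y = card (addable Y) * f Y + (\<Sum>(b, c)\<in>?S. f (insert b Y - {c}))" .
  have "up (down f) Y = (\<Sum>c\<in>removable Y. f Y + (\<Sum>b\<in>addable (Y - {c}) - {c}. f (insert b (Y - {c}))))"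
    unfolding down_def up_def
  proof (rule sum.cong[OF refl])
    fix c assume c: "c \<in> removable Y"
    then have "c \<in> addable (Y - {c})" "insert c (Y - {c}) = Y"
      using Y by (auto simp: addable_def removable_def insert_absorb)
    then show "(\<Sum>b\<in>addable (Y - {c}). f (insert b (Y - {c})))
        = f Y + (\<Sum>b\<in>addable (Y - {c}) - {c}. f (insert b (Y - {c})))"
      using finite_addable[OF remove_removable[OF c]] by (simp add: sum.remove)
  qed
  also have "\<dots> = card (removable Y) * f Y + (\<Sum>(c, b)\<in>?T. f (insert b (Y - {c})))"
    using Y by (simp add: sum.distrib sum.Sigma finite_addable finite_removable remove_removable)
  finally have ud: "up (down f) Y = card (removable Y) * f Y + (\<Sum>(c, b)\<in>?T. f (insert b (Y - {c})))" .
  have swap: "(b, c) \<in> ?S \<longleftrightarrow> (c, b) \<in> ?T" for b c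
  proof
    assume "(b, c) \<in> ?S"
    then have bc: "b \<notin> Y" "c \<in> Y" "c \<noteq> b" and D: "insert b Y - {c} \<in> young_diagrams"
      by (auto simp: addable_def removable_def)
    have "Y - {c} = Y \<inter> (insert b Y - {c})" "insert b (Y - {c}) = insert b Y - {c}"
      using bc by auto
    then have "Y - {c} \<in> young_diagrams" "insert b (Y - {c}) \<in> young_diagrams"
      using young_diagrams_Int[OF Y D] D by simp_all
    then show "(c, b) \<in> ?T" using bc by (simp add: addable_def removable_def)
  next
    assume "(c, b) \<in> ?T"
    then have bc: "b \<notin> Y" "c \<in> Y" "c \<noteq> b" and D: "insert b (Y - {c}) \<in> young_diagrams"
      by (auto simp: addable_def removable_def)
    have "insert b Y = Y \<union> insert b (Y - {c})" "insert b Y - {c} = insert b (Y - {c})"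
      using bc by auto
    then have "insert b Y \<in> young_diagrams" "insert b Y - {c} \<in> young_diagrams"
      using young_diagrams_Un[OF Y D] D by simp_all
    then show "(b, c) \<in> ?S" using bc by (simp add: addable_def removable_def)
  qed
  have "(\<Sum>(b, c)\<in>?S. f (insert b Y - {c})) = (\<Sum>(c, b)\<in>?T. f (insert b (Y - {c})))"
  proof (rule sum.reindex_bij_witness[of _ prod.swap prod.swap])
    fix p assume p: "p \<in> ?S"
    obtain b c where "p = (b, c)" by (cases p)
    then have "b \<noteq> c" using p by auto
    show "prod.swap p \<in> ?T" using p unfolding \<open>p = (b, c)\<close> swap_simp swap .
    show "(case prod.swap p of (c, b) \<Rightarrow> f (insert b (Y - {c}))) = (case p of (b, c) \<Rightarrow> f (insert b Y - {c}))"
      using \<open>b \<noteq> c\<close> \<open>p = (b, c)\<close> by (simp add: insert_Diff_if)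
  next
    fix p assume p: "p \<in> ?T"
    obtain c b where "p = (c, b)" by (cases p)
    show "prod.swap p \<in> ?S" using p unfolding \<open>p = (c, b)\<close> swap_simp swap .
  qed simp_all
  then show ?thesis
    using du ud card_addable[OF Y] by simp
qed

text \<open>\<open>up1\<close> is B and \<open>down1\<close> is A; the identity summand accounts for
  a step that leaves the shape unchanged.\<close>

definition up1 :: "((nat \<times> nat) set \<Rightarrow> nat) \<Rightarrow> (nat \<times> nat) set \<Rightarrow> nat" where
  "up1 f Y = f Y + up f Y"

definition down1 :: "((nat \<times> nat) set \<Rightarrow> nat) \<Rightarrow> (nat \<times> nat) set \<Rightarrow> nat" where
  "down1 f Y = f Y + down f Y"

text \<open>The commutation relation holds only at diagrams; since the operators evaluate their
  argument only at diagrams when applied at one, such identities may still be used under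
  them.\<close>

lemma up1_cong: "(\<And>X. X \<in> young_diagrams \<Longrightarrow> f X = g X) \<Longrightarrow> Y \<in> young_diagrams \<Longrightarrow> up1 f Y = up1 g Y"
  by (simp add: up1_def up_def remove_removable)

lemma down1_cong: "(\<And>X. X \<in> young_diagrams \<Longrightarrow> f X = g X) \<Longrightarrow> Y \<in> young_diagrams \<Longrightarrow> down1 f Y = down1 g Y"
  by (simp add: down1_def down_def insert_addable)

lemma up1_add: "up1 (\<lambda>X. f X + g X) Y = up1 f Y + up1 g Y"
  by (simp add: up1_def up_def sum.distrib)

lemma up1_mult: "up1 (\<lambda>X. c * f X) Y = c * up1 f Y"
  by (simp add: up1_def up_def sum_distrib_left distrib_left)

lemma up1_sum: "up1 (\<lambda>X. \<Sum>i\<in>I. f i X) Y = (\<Sum>i\<in>I. up1 (f i) Y)"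
  unfolding up1_def up_def sum.distrib by (subst sum.swap) simp

lemma down1_sum: "down1 (\<lambda>X. \<Sum>i\<in>I. f i X) Y = (\<Sum>i\<in>I. down1 (f i) Y)"
  unfolding down1_def down_def sum.distrib by (subst sum.swap) simp

text \<open>In (1 + D)(1 + U) and (1 + U)(1 + D) all terms but DU and UD agree, so the commutator is
  that of D and U.\<close>

lemma down1_up1:
  assumes "Y \<in> young_diagrams"
  shows "down1 (up1 f) Y = up1 (down1 f) Y + f Y"
proof -
  have "down (up1 f) Y = down f Y + down (up f) Y" "up (down1 f) Y = up f Y + up (down f) Y"
    by (simp_all add: up1_def down1_def up_def down_def sum.distrib)
  then show ?thesis
    using down_up[OF assms, of f] by (simp add: up1_def down1_def)
qed

section \<open>Powers of the operators applied to the empty diagram\<close>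

abbreviation \<delta> :: "(nat \<times> nat) set \<Rightarrow> nat" where
  "\<delta> Y \<equiv> of_bool (Y = {})"

lemma down1_delta: "down1 \<delta> Y = \<delta> Y"
  by (simp add: down1_def down_def)

lemma up1_empty: "up1 f {} = f {}"
  by (simp add: up1_def up_def removable_def)

text \<open>Moving A to the right past the \<open>j\<close> factors B leaves one extra copy of the
  power for each factor, and then A fixes \<delta>.\<close>

lemma up1_down1_up1_power:
  assumes "Y \<in> young_diagrams"
  shows "up1 (down1 ((up1 ^^ j) \<delta>)) Y = (up1 ^^ Suc j) \<delta> Y + j * (up1 ^^ j) \<delta> Y"
  using assms
proof (induction j arbitrary: Y)
  case 0
  have "down1 \<delta> = \<delta>" using down1_delta by blast
  then show ?case by simp
next
  case (Suc j)
  let ?g = "(up1 ^^ j) \<delta>"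
  have "up1 (down1 (up1 ?g)) Y = up1 (\<lambda>X. up1 (down1 ?g) X + ?g X) Y"
    by (rule up1_cong) (simp_all add: down1_up1 Suc.prems)
  \<comment> \<open>The induction hypothesis supplies \<open>j\<close> copies of \<open>?g\<close>;
    the commutator supplies one more.\<close>
  also have "\<dots> = up1 (\<lambda>X. up1 ?g X + Suc j * ?g X) Y"
    by (rule up1_cong) (use Suc in \<open>simp_all add: mult.commute\<close>)
  also have "\<dots> = up1 (up1 ?g) Y + Suc j * up1 ?g Y"
    by (simp only: up1_add up1_mult)
  finally show ?case by simp
qed

text \<open>The value at \<open>Y\<close> counts the ways to reach \<open>Y\<close> from the empty
  diagram in \<open>n\<close> half-steps, removal steps coming first. Thus
  \<open>walks (2 * n)\<close> is (BA)^n \<delta>, and one further A gives the odd case.\<close>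

fun walks :: "nat \<Rightarrow> (nat \<times> nat) set \<Rightarrow> nat" where
  "walks 0 = \<delta>"
| "walks (Suc n) = (if even n then down1 (walks n) else up1 (walks n))"

section \<open>Set partitions and Bell numbers\<close>

text \<open>Deleting \<open>a\<close> from a partition of \<open>insert a A\<close> either drops the
  block \<open>{a}\<close> or shrinks its block to some block \<open>X\<close> of a partition
  \<open>P\<close> of \<open>A\<close>. The first case adds one to the number of blocks; the second
  keeps it and offers \<open>card P\<close> choices of \<open>X\<close>.\<close>

lemma sum_partition_on_insert:
  fixes h :: "nat \<Rightarrow> nat"
  assumes "finite A" "a \<notin> A"
  shows "(\<Sum>P | partition_on (insert a A) P. h (card P))
       = (\<Sum>P | partition_on A P. h (Suc (card P)) + card P * h (card P))"
proof -
  let ?Q = "{P. partition_on A P}"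
  let ?extend = "\<lambda>(P, X). insert (insert a X) (P - {X})"
  have finQ: "finite ?Q" using assms by (simp add: finitely_many_partition_on)
  have finP: "finite P" if "P \<in> ?Q" for P
    using that assms finite_elements by blast
  have a_notin: "a \<notin> X" if "P \<in> ?Q" "X \<in> P" for P X
    using that assms partition_onD1 by blast
  have new_notin: "insert a X \<notin> P" if "P \<in> ?Q" for P X
    using a_notin[OF that] by blast
  have split: "{P. partition_on (insert a A) P} = insert {a} ` ?Q \<union> ?extend ` (SIGMA P:?Q. P)"
  proof (intro equalityI subsetI)
    fix P' assume "P' \<in> {P. partition_on (insert a A) P}"
    then have P': "partition_on (insert a A) P'" by simp
    \<comment> \<open>\<open>Z\<close> is the block of \<open>a\<close>; whether it is a singleton
      decides which of the two constructions produced \<open>P'\<close>.\<close>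
    then obtain Z where Z: "Z \<in> P'" "a \<in> Z" using partition_onD1 by blast
    define R where "R = P' - {Z}"
    have P'_eq: "P' = insert Z R" and "Z \<notin> R" using Z by (auto simp: R_def)
    have disj: "disjnt Z (\<Union>R)"
      using partition_onD2[OF P'] Z unfolding R_def by (fastforce simp: disjnt_def disjoint_def)
    have R: "partition_on (insert a A - Z) R" and Zsub: "Z \<subseteq> insert a A"
      using P' partition_on_insert[OF disj] by (auto simp: P'_eq)
    show "P' \<in> insert {a} ` ?Q \<union> ?extend ` (SIGMA P:?Q. P)"
    proof (cases "Z = {a}")
      case True
      then have "partition_on A R" using R assms by simp
      then show ?thesis using True P'_eq by blast
    next
      case False
      define X where "X = Z - {a}"
      have X: "X \<noteq> {}" "X \<subseteq> A" "Z = insert a X" using False Z Zsub by (auto simp: X_def)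
      have "insert a A - Z = A - X" using X assms by auto
      moreover have dX: "disjnt X (\<Union>R)" using disj by (auto simp: X_def disjnt_def)
      ultimately have part: "partition_on A (insert X R)"
        using R X partition_on_insert by metis
      have "X \<notin> R" using dX X(1) by (auto simp: disjnt_def)
      then have "P' = ?extend (insert X R, X)" using P'_eq X(3) by simp
      then show ?thesis using part by blast
    qed
  next
    fix P' assume "P' \<in> insert {a} ` ?Q \<union> ?extend ` (SIGMA P:?Q. P)"
    then consider P where "P \<in> ?Q" "P' = insert {a} P"
      | P X where "P \<in> ?Q" "X \<in> P" "P' = insert (insert a X) (P - {X})" by auto
    then show "P' \<in> {P. partition_on (insert a A) P}"
    proof cases
      case 1
      then show ?thesis
        using assms a_notin[of P] partition_on_insert[of "{a}" P "insert a A"] by (auto simp: disjnt_def)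
    next
      case 2
      have dX: "disjnt X (\<Union>(P - {X}))"
        using 2 partition_onD2[of A P] by (fastforce simp: disjnt_def disjoint_def)
      have "partition_on A (insert X (P - {X}))" using 2 by (simp add: insert_absorb)
      then have "partition_on (A - X) (P - {X})" "X \<subseteq> A" using partition_on_insert[OF dX] by auto
      moreover have "A - X = insert a A - insert a X" using assms by auto
      moreover have "disjnt (insert a X) (\<Union>(P - {X}))" using dX a_notin[OF 2(1)] by (auto simp: disjnt_def)
      ultimately show ?thesis
        using \<open>X \<subseteq> A\<close> 2(3) by (subst mem_Collect_eq) (auto simp: partition_on_insert)
    qed
  qed
  have disj: "insert {a} ` ?Q \<inter> ?extend ` (SIGMA P:?Q. P) = {}"
  proof -
    \<comment> \<open>In a coincidence, the blocks containing \<open>a\<close> must agree, so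
      \<open>X\<close> would be empty, which no block is.\<close>
    have False if "P \<in> ?Q" "P1 \<in> ?Q" "X \<in> P1" "insert {a} P = insert (insert a X) (P1 - {X})" for P P1 X
    proof -
      have "{a} = insert a X" using that(4) a_notin[OF that(2)] by (metis DiffD1 insertI1 insert_iff)
      then have "X = {}" using a_notin[OF that(2,3)] by auto
      then show False using that partition_onD3 by blast
    qed
    then show ?thesis by fastforce
  qed
  have inj1: "inj_on (insert {a}) ?Q"
    by (rule inj_onI) (use new_notin[of _ "{}"] in \<open>metis insert_ident\<close>)
  have inj2: "inj_on ?extend (SIGMA P:?Q. P)"
  proof (rule inj_onI, clarify)
    fix P X P1 X1 
    assume P: "partition_on A P" "X \<in> P" and P1: "partition_on A P1" "X1 \<in> P1"
      and eq: "insert (insert a X) (P - {X}) = insert (insert a X1) (P1 - {X1})"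
    \<comment> \<open>Only one block on each side contains \<open>a\<close>, so the enlarged block,
      and with it \<open>X\<close>, can be recovered.\<close>
    have "insert a X = insert a X1"
      using eq a_notin[of P1] P1 by (metis DiffD1 insertI1 insert_iff mem_Collect_eq)
    then have "X = X1" using a_notin[of P X] a_notin[of P1 X1] P P1 by (simp add: insert_ident)
    moreover have "P - {X} = P1 - {X1}"
      using eq new_notin[of P X] new_notin[of P1 X1] P P1 \<open>insert a X = insert a X1\<close>
      by (metis DiffD1 insert_ident mem_Collect_eq)
    ultimately show "P = P1 \<and> X = X1" using P P1 by (metis insert_Diff)
  qed
  have "(\<Sum>P | partition_on (insert a A) P. h (card P))
      = (\<Sum>P\<in>insert {a} ` ?Q. h (card P)) + (\<Sum>P\<in>?extend ` (SIGMA P:?Q. P). h (card P))"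
    unfolding split using finQ finP disj by (intro sum.union_disjoint finite_imageI finite_SigmaI)
  also have "(\<Sum>P\<in>insert {a} ` ?Q. h (card P)) = (\<Sum>P\<in>?Q. h (Suc (card P)))"
    using new_notin[of _ "{}"] finP by (simp add: sum.reindex[OF inj1])
  also have "(\<Sum>P\<in>?extend ` (SIGMA P:?Q. P). h (card P)) = (\<Sum>(P, X)\<in>(SIGMA P:?Q. P). h (card P))"
  proof (subst sum.reindex[OF inj2], rule sum.cong[OF refl], clarsimp)
    fix P X assume P: "partition_on A P" "X \<in> P"
    then have "card (insert (insert a X) (P - {X})) = card P"
      using finP[of P] new_notin[of P X] card_Suc_Diff1[of P X] by simp
    then show "h (card (insert (insert a X) (P - {X}))) = h (card P)" by simp
  qed
  also have "\<dots> = (\<Sum>P\<in>?Q. card P * h (card P))"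
    using finQ finP by (simp add: sum.Sigma[symmetric])
  finally show ?thesis by (simp add: sum.distrib)
qed

text \<open>By linearity BA acts on each summand separately, and its effect on the power with
  exponent \<open>card P\<close> matches the ways of inserting \<open>Suc n\<close> into
  \<open>P\<close>.\<close>

lemma walks_even:
  assumes "Y \<in> young_diagrams"
  shows "walks (2 * n) Y = (\<Sum>P | partition_on {1..n} P. (up1 ^^ card P) \<delta> Y)"
  using assms
proof (induction n arbitrary: Y)
  case 0
  have "{P. partition_on {1..0::nat} P} = {{}}"
    by (auto simp: partition_on_empty)
  then show ?case by simp
next
  case (Suc n)
  have "walks (2 * Suc n) Y = up1 (down1 (walks (2 * n))) Y"
    by simp
  also have "\<dots> = up1 (down1 (\<lambda>X. \<Sum>P | partition_on {1..n} P. (up1 ^^ card P) \<delta> X)) Y"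
    by (intro up1_cong down1_cong Suc)
  also have "\<dots> = up1 (\<lambda>X. \<Sum>P | partition_on {1..n} P. down1 ((up1 ^^ card P) \<delta>) X) Y"
    by (intro up1_cong down1_sum Suc.prems)
  also have "\<dots> = (\<Sum>P | partition_on {1..n} P. up1 (down1 ((up1 ^^ card P) \<delta>)) Y)"
    by (rule up1_sum)
  also have "\<dots> = (\<Sum>P | partition_on {1..n} P. (up1 ^^ Suc (card P)) \<delta> Y + card P * (up1 ^^ card P) \<delta> Y)"
    by (simp only: up1_down1_up1_power[OF Suc.prems])
  also have "\<dots> = (\<Sum>P | partition_on (insert (Suc n) {1..n}) P. (up1 ^^ card P) \<delta> Y)"
    by (rule sum_partition_on_insert[symmetric]) simp_all
  finally show ?case by (simp add: atLeastAtMostSuc_conv)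
qed

text \<open>No box can be removed from the empty diagram, so every power of B has value 1 there and
  the sum merely counts partitions.\<close>

lemma walks_even_empty: "walks (2 * n) {} = bell n"
proof -
  have "(up1 ^^ j) \<delta> {} = 1" for j
    by (induction j) (simp_all add: up1_empty)
  then show ?thesis by (simp add: walks_even bell_def)
qed

section \<open>Support of the walk counts and adjointness\<close>

text \<open>Only every second half-step can add a box, so \<open>n\<close> half-steps reach at most
  \<open>n div 2\<close> boxes.\<close>

lemma walks_eq_0:
  assumes "Y \<in> young_diagrams" "n < 2 * card Y"
  shows "walks n Y = 0"
  using assms
proof (induction n arbitrary: Y)
  case 0
  then show ?case by auto
next
  case (Suc n)
  have fin: "finite Y" using Suc.prems by (simp add: finite_young_diagram)
  show ?case
  proof (cases "even n")
    case True
    have "walks n (insert b Y) = 0" if "b \<in> addable Y" for b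
      using Suc fin that by (intro Suc.IH) (auto simp: addable_def)
    then show ?thesis
      using True Suc by (simp add: down1_def down_def)
  next
    case False
    have "walks n (Y - {b}) = 0" if "b \<in> removable Y" for b
    proof (rule Suc.IH[OF remove_removable[OF that]])
      \<comment> \<open>As \<open>n\<close> is odd, \<open>Suc n < 2 * card Y\<close> compares even
        numbers, so the gap is at least 2, enough to pay for the removed box.\<close>
      show "n < 2 * card (Y - {b})"
        using False Suc.prems fin that by (auto simp: removable_def elim!: oddE) arith
    qed
    then show ?thesis
      using False Suc by (simp add: up1_def up_def)
  qed
qed

text \<open>Removing \<open>b\<close> from \<open>Y\<close> and adding it back match the terms of
  the two sums. The size bound breaks this symmetry only at size \<open>N\<close>, where a box added
  to the diagram leaves the range; the hypothesis on \<open>f\<close> makes those terms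
  vanish.\<close>

lemma up1_down1_adjoint:
  assumes "\<And>Y. Y \<in> young_diagrams \<Longrightarrow> card Y = N \<Longrightarrow> f Y = 0"
  shows "(\<Sum>Y | Y \<in> young_diagrams \<and> card Y \<le> N. up1 f Y * g Y)
       = (\<Sum>Y | Y \<in> young_diagrams \<and> card Y \<le> N. f Y * down1 g Y)"
proof -
  let ?S = "{Y. Y \<in> young_diagrams \<and> card Y \<le> N}"
  let ?T = "{Y. Y \<in> young_diagrams \<and> card Y < N}"
  have finS: "finite ?S" by (rule finite_young_diagrams_card_le)
  have finT: "finite ?T" by (rule finite_subset[OF _ finS]) auto
  have "(\<Sum>Y\<in>?S. up f Y * g Y) = (\<Sum>(Y, b)\<in>(SIGMA Y:?S. removable Y). f (Y - {b}) * g Y)"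
    using finS by (simp add: up_def sum_distrib_right sum.Sigma finite_removable)
  also have "\<dots> = (\<Sum>(Y, b)\<in>(SIGMA Y:?T. addable Y). f Y * g (insert b Y))"
  proof (rule sum.reindex_bij_witness[of _ "\<lambda>(Y, b). (insert b Y, b)" "\<lambda>(Y, b). (Y - {b}, b)"])
    fix p assume p: "p \<in> (SIGMA Y:?S. removable Y)"
    obtain Y b where Yb: "Y \<in> ?S" "b \<in> removable Y" "p = (Y, b)" using p by (rule SigmaE)
    then have "b \<in> Y" "Y - {b} \<in> young_diagrams" "insert b (Y - {b}) = Y" "finite Y"
      by (auto simp: removable_def finite_young_diagram)
    moreover from this have "card (Y - {b}) < card Y" by (intro psubset_card_mono) auto
    ultimately show "(case case p of (Y, b) \<Rightarrow> (Y - {b}, b) of (Y, b) \<Rightarrow> (insert b Y, b)) = p"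
      "(case p of (Y, b) \<Rightarrow> (Y - {b}, b)) \<in> (SIGMA Y:?T. addable Y)"
      "(case case p of (Y, b) \<Rightarrow> (Y - {b}, b) of (Y, b) \<Rightarrow> f Y * g (insert b Y))
        = (case p of (Y, b) \<Rightarrow> f (Y - {b}) * g Y)"
      using Yb by (simp_all add: addable_def)
  next
    fix p assume p: "p \<in> (SIGMA Y:?T. addable Y)"
    obtain Y b where Yb: "Y \<in> ?T" "b \<in> addable Y" "p = (Y, b)" using p by (rule SigmaE)
    then have "b \<notin> Y" "insert b Y \<in> young_diagrams" "finite Y"
      by (auto simp: addable_def finite_young_diagram)
    then show "(case case p of (Y, b) \<Rightarrow> (insert b Y, b) of (Y, b) \<Rightarrow> (Y - {b}, b)) = p"
      "(case p of (Y, b) \<Rightarrow> (insert b Y, b)) \<in> (SIGMA Y:?S. removable Y)"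
      using Yb by (simp_all add: removable_def)
  qed
  also have "\<dots> = (\<Sum>Y\<in>?T. f Y * down g Y)"
    using finT by (simp add: down_def sum_distrib_left sum.Sigma finite_addable)
  also have "\<dots> = (\<Sum>Y\<in>?S. f Y * down g Y)"
    by (rule sum.mono_neutral_left[OF finS]) (use assms in \<open>auto simp: le_less\<close>)
  finally show ?thesis
    by (simp add: up1_def down1_def distrib_left distrib_right sum.distrib)
qed

text \<open>Operators are moved one at a time from the first factor to the second until \<delta> is
  left, which evaluates at the empty diagram. Since \<open>m + n\<close> is even, the adjoint of the
  operator taken from one factor is exactly the next one due in the other.\<close>

lemma sum_walks_mult_walks:
  assumes "even (m + n)" "m + n < N"
  shows "(\<Sum>Y | Y \<in> young_diagrams \<and> card Y \<le> N. walks m Y * walks n Y) = walks (m + n) {}"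
  using assms
proof (induction m arbitrary: n)
  case 0
  have "(\<Sum>Y | Y \<in> young_diagrams \<and> card Y \<le> N. \<delta> Y * walks n Y) = (\<Sum>Y\<in>{{}}. \<delta> Y * walks n Y)"
    by (rule sum.mono_neutral_right) (auto simp: finite_young_diagrams_card_le)
  then show ?case by simp
next
  case (Suc m)
  let ?S = "{Y. Y \<in> young_diagrams \<and> card Y \<le> N}"
  have "(\<Sum>Y\<in>?S. walks (Suc m) Y * walks n Y) = (\<Sum>Y\<in>?S. walks m Y * walks (Suc n) Y)"
  proof (cases "even m")
    case True
    \<comment> \<open>The first factor loses \<open>down1\<close>, so adjointness is applied with
      the two factors exchanged.\<close>
    have "(\<Sum>Y\<in>?S. up1 (walks n) Y * walks m Y) = (\<Sum>Y\<in>?S. walks n Y * down1 (walks m) Y)"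
      using Suc.prems by (intro up1_down1_adjoint walks_eq_0) simp_all
    then show ?thesis using True Suc.prems by (simp add: mult.commute)
  next
    case False
    have "(\<Sum>Y\<in>?S. up1 (walks m) Y * walks n Y) = (\<Sum>Y\<in>?S. walks m Y * down1 (walks n) Y)"
      using Suc.prems by (intro up1_down1_adjoint walks_eq_0) simp_all
    then show ?thesis using False Suc.prems by simp
  qed
  then show ?case using Suc.IH[of "Suc n"] Suc.prems by simp
qed

section \<open>Integer partitions and their diagrams\<close>

lemma integer_partition_antimono:
  assumes "integer_partition lam"
  shows "antimono (\<lambda>i. if i < length lam then lam ! i else 0)"
proof (rule antimonoI)
  fix x y :: nat assume "x \<le> y"
  then show "(if y < length lam then lam ! y else 0) \<le> (if x < length lam then lam ! x else 0)"
    using assms unfolding integer_partition_def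
    by (cases "x = y") (auto simp: sorted_wrt_iff_nth_less)
qed

lemma young_diagram_alt:
  "young_diagram lam = {(i, j). j < (if i < length lam then lam ! i else 0)}"
  by (auto simp: young_diagram_def split: if_splits)

lemma young_diagram_in_young_diagrams:
  assumes "integer_partition lam"
  shows "young_diagram lam \<in> young_diagrams"
  unfolding young_diagram_alt row_lengths_in_young_diagrams_iff
  using integer_partition_antimono[OF assms] by (auto intro: finite_subset[of _ "{..<length lam}"])

lemma inj_on_young_diagram: "inj_on young_diagram {lam. integer_partition lam}"
proof (rule inj_onI, clarify)
  fix lam mu assume p: "integer_partition lam" "integer_partition mu"
    and eq: "young_diagram lam = young_diagram mu"
  \<comment> \<open>Positivity of the parts makes the first column as long as the list; without it,
    trailing zeros would be invisible in the diagram.\<close>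
  have len: "{i. (i, 0) \<in> young_diagram l} = {..<length l}" if "integer_partition l" for l
    using that unfolding young_diagram_def integer_partition_def
    by (auto intro!: gr0I) (metis nth_mem)
  have "length lam = length mu"
    using len[OF p(1)] len[OF p(2)] eq by simp
  moreover have "lam ! i = mu ! i" if "i < length lam" for i
  proof -
    have "{j. (i, j) \<in> young_diagram lam} = {..<lam ! i}" "{j. (i, j) \<in> young_diagram mu} = {..<mu ! i}"
      using that \<open>length lam = length mu\<close> by (auto simp: young_diagram_def)
    then show ?thesis using eq by simp
  qed
  ultimately show "lam = mu" by (rule nth_equalityI)
qed

lemma ex_integer_partition:
  assumes "Y \<in> young_diagrams"
  obtains lam where "integer_partition lam" "young_diagram lam = Y"
proof -
  obtain r where r: "antimono r" "finite {i. r i \<noteq> 0}" and Y: "Y = {(i, j). j < r i}"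
    using assms by (rule young_diagrams_row_lengths)
  \<comment> \<open>By monotonicity the rows vanish exactly from \<open>n\<close> on, so cutting
    there leaves only positive parts.\<close>
  define n where "n = (LEAST i. r i = 0)"
  have "\<exists>i. r i = 0"
    using r(2) by (metis (mono_tags, lifting) ex_new_if_finite infinite_UNIV_nat mem_Collect_eq)
  then have "r n = 0" unfolding n_def by (rule LeastI_ex)
  then have zero: "r i = 0 \<longleftrightarrow> n \<le> i" for i
    using antimonoD[OF r(1), of n i] Least_le[of "\<lambda>i. r i = 0" i] by (auto simp: n_def)
  let ?lam = "map r [0..<n]"
  have "integer_partition ?lam"
    using r(1) zero by (auto simp: integer_partition_def sorted_wrt_iff_nth_less antimonoD)
  moreover have "young_diagram ?lam = Y"
  proof -
    have "j < r i \<Longrightarrow> i < n" for i j using zero[of i] by (cases "n \<le> i") auto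
    then show ?thesis unfolding young_diagram_def Y by auto
  qed
  ultimately show ?thesis by (rule that)
qed

lemma card_young_diagram: "card (young_diagram lam) = sum_list lam"
proof -
  have "young_diagram lam = (SIGMA i:{0..<length lam}. {..<lam ! i})"
    by (auto simp: young_diagram_def)
  then show ?thesis by (simp add: sum_list_sum_nth)
qed

lemma young_diagram_eq_empty_iff:
  assumes "integer_partition lam"
  shows "young_diagram lam = {} \<longleftrightarrow> lam = []"
  using inj_onD[OF inj_on_young_diagram, of lam "[]"] assms
  by (auto simp: integer_partition_def young_diagram_def)

lemma bij_betw_remove_box:
  assumes "integer_partition lam"
  shows "bij_betw young_diagram {mu. remove_box lam mu}
    ((\<lambda>b. young_diagram lam - {b}) ` removable (young_diagram lam))"
proof (rule bij_betw_imageI)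
  show "inj_on young_diagram {mu. remove_box lam mu}"
    by (rule inj_on_subset[OF inj_on_young_diagram]) (auto simp: remove_box_def)
  show "young_diagram ` {mu. remove_box lam mu}
      = (\<lambda>b. young_diagram lam - {b}) ` removable (young_diagram lam)"
  proof (intro equalityI subsetI)
    fix Y assume "Y \<in> young_diagram ` {mu. remove_box lam mu}"
    then obtain mu b where "integer_partition mu" "Y = young_diagram mu" "b \<in> young_diagram lam"
      "young_diagram mu = young_diagram lam - {b}" by (auto simp: remove_box_def)
    then show "Y \<in> (\<lambda>b. young_diagram lam - {b}) ` removable (young_diagram lam)"
      using young_diagram_in_young_diagrams[of mu] by (auto simp: removable_def)
  next
    fix Y assume "Y \<in> (\<lambda>b. young_diagram lam - {b}) ` removable (young_diagram lam)"
    then obtain b where b: "b \<in> young_diagram lam" "Y = young_diagram lam - {b}" "Y \<in> young_diagrams"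
      by (auto simp: removable_def)
    obtain mu where mu: "integer_partition mu" "young_diagram mu = Y"
      using ex_integer_partition[OF b(3)] .
    then have "remove_box lam mu"
      using b assms unfolding remove_box_def by blast
    then show "Y \<in> young_diagram ` {mu. remove_box lam mu}"
      using mu by blast
  qed
qed

lemma bij_betw_add_box:
  assumes "integer_partition lam"
  shows "bij_betw young_diagram {mu. add_box lam mu}
    ((\<lambda>b. insert b (young_diagram lam)) ` addable (young_diagram lam))"
proof (rule bij_betw_imageI)
  show "inj_on young_diagram {mu. add_box lam mu}"
    by (rule inj_on_subset[OF inj_on_young_diagram]) (auto simp: add_box_def)
  show "young_diagram ` {mu. add_box lam mu}
      = (\<lambda>b. insert b (young_diagram lam)) ` addable (young_diagram lam)"
  proof (intro equalityI subsetI)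
    fix Y assume "Y \<in> young_diagram ` {mu. add_box lam mu}"
    then obtain mu b where "integer_partition mu" "Y = young_diagram mu" "b \<notin> young_diagram lam"
      "young_diagram mu = insert b (young_diagram lam)" by (auto simp: add_box_def)
    then show "Y \<in> (\<lambda>b. insert b (young_diagram lam)) ` addable (young_diagram lam)"
      using young_diagram_in_young_diagrams[of mu] by (auto simp: addable_def)
  next
    fix Y assume "Y \<in> (\<lambda>b. insert b (young_diagram lam)) ` addable (young_diagram lam)"
    then obtain b where b: "b \<notin> young_diagram lam" "Y = insert b (young_diagram lam)" "Y \<in> young_diagrams"
      by (auto simp: addable_def)
    obtain mu where mu: "integer_partition mu" "young_diagram mu = Y"
      using ex_integer_partition[OF b(3)] .
    then have "add_box lam mu"
      using b assms unfolding add_box_def by blast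
    then show "Y \<in> young_diagram ` {mu. add_box lam mu}"
      using mu by blast
  qed
qed

text \<open>Lets a removal step be read backwards: the predecessors of a shape are found by adding a
  box to it.\<close>

lemma remove_box_iff_add_box: "remove_box mu lam \<longleftrightarrow> add_box lam mu"
proof -
  have "(\<exists>b\<in>X. Y = X - {b}) \<longleftrightarrow> (\<exists>b. b \<notin> Y \<and> X = insert b Y)" for X Y :: "(nat \<times> nat) set"
    by blast
  then show ?thesis unfolding remove_box_def add_box_def by blast
qed

lemma sum_add_box:
  fixes g :: "(nat \<times> nat) set \<Rightarrow> nat"
  assumes "integer_partition lam"
  shows "finite {mu. add_box lam mu}"
    and "(\<Sum>mu | mu = lam \<or> add_box lam mu. g (young_diagram mu)) = down1 g (young_diagram lam)"
proof -
  let ?Y = "young_diagram lam"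
  note bij = bij_betw_add_box[OF assms]
  have fin: "finite (addable ?Y)"
    using assms by (intro finite_addable young_diagram_in_young_diagrams)
  then show finite: "finite {mu. add_box lam mu}"
    using bij_betw_finite[OF bij] by simp
  have "(\<Sum>mu | add_box lam mu. g (young_diagram mu)) = sum g ((\<lambda>b. insert b ?Y) ` addable ?Y)"
    by (rule sum.reindex_bij_betw[OF bij])
  also have "\<dots> = down g ?Y"
    unfolding down_def by (rule sum.reindex_cong) (auto simp: inj_on_def addable_def)
  finally have "(\<Sum>mu | add_box lam mu. g (young_diagram mu)) = down g ?Y" .
  moreover have "{mu. mu = lam \<or> add_box lam mu} = insert lam {mu. add_box lam mu}" by auto
  \<comment> \<open>The stationary term is therefore not counted a second time as an
    addition.\<close>
  moreover have "\<not> add_box lam lam" by (auto simp: add_box_def)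
  ultimately show "(\<Sum>mu | mu = lam \<or> add_box lam mu. g (young_diagram mu)) = down1 g ?Y"
    using finite by (simp add: down1_def)
qed

lemma sum_remove_box:
  fixes g :: "(nat \<times> nat) set \<Rightarrow> nat"
  assumes "integer_partition lam"
  shows "finite {mu. remove_box lam mu}"
    and "(\<Sum>mu | mu = lam \<or> remove_box lam mu. g (young_diagram mu)) = up1 g (young_diagram lam)"
proof -
  let ?Y = "young_diagram lam"
  note bij = bij_betw_remove_box[OF assms]
  have fin: "finite (removable ?Y)"
    using assms by (intro finite_removable young_diagram_in_young_diagrams)
  then show finite: "finite {mu. remove_box lam mu}"
    using bij_betw_finite[OF bij] by simp
  have "(\<Sum>mu | remove_box lam mu. g (young_diagram mu)) = sum g ((\<lambda>b. ?Y - {b}) ` removable ?Y)"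
    by (rule sum.reindex_bij_betw[OF bij])
  also have "\<dots> = up g ?Y"
    unfolding up_def by (rule sum.reindex_cong) (auto simp: inj_on_def removable_def)
  finally have "(\<Sum>mu | remove_box lam mu. g (young_diagram mu)) = up g ?Y" .
  moreover have "{mu. mu = lam \<or> remove_box lam mu} = insert lam {mu. remove_box lam mu}" by auto
  moreover have "\<not> remove_box lam lam" by (auto simp: remove_box_def)
  ultimately show "(\<Sum>mu | mu = lam \<or> remove_box lam mu. g (young_diagram mu)) = up1 g ?Y"
    using finite by (simp add: up1_def)
qed

section \<open>Vacillating tableaux counted by walks\<close>

text \<open>One relation indexed by the parity of the step merges the two step conditions, so that
  induction can proceed by single half-steps.\<close>

definition vacillating_step :: "nat \<Rightarrow> nat list \<Rightarrow> nat list \<Rightarrow> bool" where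
  "vacillating_step n mu lam \<longleftrightarrow> lam = mu \<or> (if even n then remove_box mu lam else add_box mu lam)"

lemma vacillating_tableaux_alt:
  "vacillating_tableaux n lam =
     {T. length T = Suc n \<and> (\<forall>mu\<in>set T. integer_partition mu) \<and> T ! 0 = [] \<and> T ! n = lam \<and>
         (\<forall>i<n. vacillating_step i (T ! i) (T ! Suc i))}"
proof -
  have parity: "(\<forall>i. 2 * i + 1 \<le> n \<longrightarrow> P (2 * i)) \<and> (\<forall>i. 2 * i + 2 \<le> n \<longrightarrow> P (2 * i + 1)) \<longleftrightarrow> (\<forall>i<n. P i)"
    for P :: "nat \<Rightarrow> bool"
  proof
    assume *: "(\<forall>i. 2 * i + 1 \<le> n \<longrightarrow> P (2 * i)) \<and> (\<forall>i. 2 * i + 2 \<le> n \<longrightarrow> P (2 * i + 1))"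
    show "\<forall>i<n. P i"
    proof (intro allI impI)
      fix i assume "i < n"
      then show "P i" using * by (cases "even i") (auto elim!: evenE oddE)
    qed
  qed auto
  show ?thesis
    unfolding vacillating_tableaux_def parity[of "\<lambda>i. vacillating_step i (_ ! i) (_ ! Suc i)", symmetric]
    by (simp add: vacillating_step_def)
qed

lemma vacillating_tableaux_Suc:
  assumes "integer_partition lam"
  shows "vacillating_tableaux (Suc n) lam
       = (\<Union>mu\<in>{mu. vacillating_step n mu lam}. (\<lambda>T. T @ [lam]) ` vacillating_tableaux n mu)"
proof (intro equalityI subsetI)
  fix T assume T: "T \<in> vacillating_tableaux (Suc n) lam"
  then have len: "length T = Suc (Suc n)" and last: "T ! Suc n = lam"
    by (auto simp: vacillating_tableaux_alt)
  then have T_eq: "T = butlast T @ [lam]"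
    by (metis append_butlast_last_id diff_Suc_1 last_conv_nth length_0_conv nat.distinct(1))
  have nth: "butlast T ! i = T ! i" if "i \<le> n" for i
    using that len by (simp add: nth_butlast)
  have "butlast T \<in> vacillating_tableaux n (T ! n)"
    using T len nth in_set_butlastD[of _ T] by (auto simp: vacillating_tableaux_alt)
  moreover have "vacillating_step n (T ! n) lam"
    using T last by (auto simp: vacillating_tableaux_alt)
  ultimately show "T \<in> (\<Union>mu\<in>{mu. vacillating_step n mu lam}. (\<lambda>T. T @ [lam]) ` vacillating_tableaux n mu)"
    using T_eq by blast
next
  fix T assume "T \<in> (\<Union>mu\<in>{mu. vacillating_step n mu lam}. (\<lambda>T. T @ [lam]) ` vacillating_tableaux n mu)"
  then obtain mu S where "vacillating_step n mu lam" "S \<in> vacillating_tableaux n mu" "T = S @ [lam]"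
    by blast
  then show "T \<in> vacillating_tableaux (Suc n) lam"
    using assms by (auto simp: vacillating_tableaux_alt nth_append less_Suc_eq)
qed

text \<open>The sum runs over the shapes before the step: ahead of a removal these are
  \<open>lam\<close> and its enlargements, whence \<open>down1\<close> for even \<open>n\<close>,
  and dually for odd \<open>n\<close>.\<close>

lemma sum_vacillating_step:
  fixes g :: "(nat \<times> nat) set \<Rightarrow> nat"
  assumes "integer_partition lam"
  shows "finite {mu. vacillating_step n mu lam}"
    and "(\<Sum>mu | vacillating_step n mu lam. g (young_diagram mu))
       = (if even n then down1 g (young_diagram lam) else up1 g (young_diagram lam))"
proof -
  have *: "{mu. vacillating_step n mu lam}
    = (if even n then {mu. mu = lam \<or> add_box lam mu} else {mu. mu = lam \<or> remove_box lam mu})"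
    by (auto simp: vacillating_step_def remove_box_iff_add_box)
  show "finite {mu. vacillating_step n mu lam}"
    unfolding * using sum_add_box(1)[OF assms] sum_remove_box(1)[OF assms] by (simp add: Collect_disj_eq)
  show "(\<Sum>mu | vacillating_step n mu lam. g (young_diagram mu))
       = (if even n then down1 g (young_diagram lam) else up1 g (young_diagram lam))"
    unfolding * using sum_add_box(2)[OF assms] sum_remove_box(2)[OF assms] by simp
qed

lemma card_vacillating_tableaux:
  assumes "integer_partition lam"
  shows "finite (vacillating_tableaux n lam) \<and> card (vacillating_tableaux n lam) = walks n (young_diagram lam)"
  using assms
proof (induction n arbitrary: lam)
  case 0
  \<comment> \<open>The only tableau of length 0 is the list whose single entry is the empty
    partition.\<close>
  have "vacillating_tableaux 0 lam = (if lam = [] then {[[]]} else {})"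
    by (auto simp: vacillating_tableaux_alt length_Suc_conv integer_partition_def)
  then show ?case using young_diagram_eq_empty_iff[OF 0] by simp
next
  case (Suc n)
  let ?M = "{mu. vacillating_step n mu lam}" and ?V = "\<lambda>mu. (\<lambda>T. T @ [lam]) ` vacillating_tableaux n mu"
  have finM: "finite ?M" by (rule sum_vacillating_step(1)[OF Suc.prems])
  have part: "integer_partition mu" if "mu \<in> ?M" for mu
    using that Suc.prems by (auto simp: vacillating_step_def remove_box_def add_box_def split: if_splits)
  have finV: "finite (?V mu)" if "mu \<in> ?M" for mu
    using Suc.IH[OF part[OF that]] by simp
  \<comment> \<open>The union is disjoint because the entry just before the appended
    \<open>lam\<close> is \<open>mu\<close> itself.\<close>
  have "card (\<Union>mu\<in>?M. ?V mu) = (\<Sum>mu\<in>?M. card (?V mu))"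
    using finM finV by (intro card_UN_disjoint) (auto simp: vacillating_tableaux_alt)
  also have "\<dots> = (\<Sum>mu\<in>?M. walks n (young_diagram mu))"
    using Suc.IH[OF part] by (intro sum.cong) (simp_all add: card_image inj_on_def)
  also have "\<dots> = walks (Suc n) (young_diagram lam)"
    by (simp add: sum_vacillating_step(2)[OF Suc.prems])
  finally show ?case
    using finM finV by (simp add: vacillating_tableaux_Suc[OF Suc.prems])
qed

section \<open>Sum of squared multiplicities as a walk count at the empty diagram\<close>

theorem mainTheorem6:
  fixes k :: nat
  assumes "k \<ge> 1"
  shows "bell (2 * k - 1) = (\<Sum>lam \<in> Gamma (real k - 1 / 2). (m_half k lam)\<^sup>2)"
proof -
  \<comment> \<open>\<open>?N\<close> only has to exceed \<open>?n + ?n\<close>, which is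
    \<open>4 * k - 2\<close>.\<close>
  let ?n = "2 * k - 1" and ?N = "4 * k"
  let ?G = "Gamma (real k - 1 / 2)"
  have G: "?G = {lam. integer_partition lam \<and> sum_list lam < k}"
    by (auto simp: Gamma_def)
  have inj: "inj_on young_diagram ?G"
    by (rule inj_on_subset[OF inj_on_young_diagram]) (auto simp: G)
  have image: "young_diagram ` ?G = {Y. Y \<in> young_diagrams \<and> card Y < k}"
    by (auto simp: G card_young_diagram young_diagram_in_young_diagrams elim!: ex_integer_partition)
  have "(\<Sum>lam\<in>?G. (m_half k lam)\<^sup>2) = (\<Sum>lam\<in>?G. (walks ?n (young_diagram lam))\<^sup>2)"
    by (rule sum.cong) (simp_all add: G m_half_def card_vacillating_tableaux)
  also have "\<dots> = (\<Sum>Y | Y \<in> young_diagrams \<and> card Y < k. (walks ?n Y)\<^sup>2)"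
    unfolding image[symmetric] sum.reindex[OF inj] by simp
  also have "\<dots> = (\<Sum>Y | Y \<in> young_diagrams \<and> card Y \<le> ?N. walks ?n Y * walks ?n Y)"
    unfolding power2_eq_square
  proof (rule sum.mono_neutral_left)
    \<comment> \<open>In \<open>2 * k - 1\<close> half-steps at most \<open>k - 1\<close> boxes are
      reached, so enlarging the range to size \<open>?N\<close> adds only zeros.\<close>
    have "walks ?n Y = 0" if "Y \<in> young_diagrams" "\<not> card Y < k" for Y
      by (rule walks_eq_0) (use that assms in simp_all)
    then show "\<forall>Y\<in>{Y. Y \<in> young_diagrams \<and> card Y \<le> ?N} - {Y. Y \<in> young_diagrams \<and> card Y < k}.
        walks ?n Y * walks ?n Y = 0"
      by simp
  qed (auto simp: finite_young_diagrams_card_le)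
  also have "\<dots> = walks (2 * ?n) {}"
    using assms by (subst sum_walks_mult_walks) (simp_all add: mult_2)
  also have "\<dots> = bell ?n"
    by (rule walks_even_empty)
  finally show ?thesis by simp
qed

end
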